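(* Let $1\le p_0<\infty$ and let $a=\{a(n)\}_{n\in\mathbb{Z}}$ be a real sequence with $a\in\ell^{p_0}(\mathbb{Z})$. Then for all real $\gamma>0$ and $\lambda>0$, $$\bigl|\{n\in\mathbb{Z}: M_d a(n)>2\lambda,\ M^{\#}a(n)\le\gamma\lambda\}\bigr|\ \le\ 2\gamma\,\bigl|\{n\in\mathbb{Z}: M_d a(n)>\lambda\}\bigr|,$$ where $M_d$ is the dyadic Hardy-Littlewood maximal operator and $M^{\#}$ is the sharp maximal operator.
   Context: An interval in $\mathbb{Z}$ is a finite nonempty set of consecutive integers; $|S|$ denotes the cardinality of $S\subset\mathbb{Z}$. The dyadic intervals in $\mathbb{Z}$ are the sets $I_{N,j}=\{(j-1)2^N+1,\dots,j2^N\}$ with $N$ a positive integer ($N\ge 1$) and $j\in\mathbb{Z}$. For a real sequence $a$ and $m\in\mathbb{Z}$ define: Dyadic Hardy-Littlewood maximal operator: $M_d a(m)=\sup_{I\ni m}\frac{1}{|I|}\sum_{k\in I}|a(k)|$, the supremum being over all dyadic intervals $I$ containing $m$. Sharp maximal operator: $M^{\#}a(m)=\sup_{I\ni m}\frac{1}{|I|}\sum_{n\in I}|a(n)-a_I|$, the supremum being over all intervals $I$ in $\mathbb{Z}$ containing $m$, where $a_I=\frac{1}{|I|}\sum_{k\in I}a(k)$. *)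

theory Defs
  imports "HOL-Analysis.Analysis"
begin

definition int_intervals :: "int set set" where
  "int_intervals = {{i..j} | i j. i \<le> j}"

definition dyadic_interval :: "nat \<Rightarrow> int \<Rightarrow> int set" where
  "dyadic_interval N j = {(j - 1) * 2 ^ N + 1 .. j * 2 ^ N}"

text \<open>The scale starts at 1, so singletons are not dyadic intervals.\<close>

definition dyadic_intervals :: "int set set" where
  "dyadic_intervals = {dyadic_interval N j | N j. 1 \<le> N}"

definition interval_avg :: "(int \<Rightarrow> real) \<Rightarrow> int set \<Rightarrow> real" where
  "interval_avg a I = (\<Sum>k\<in>I. a k) / real (card I)"

text \<open>The maximal operators take values in \<open>[0, \<infinity>]\<close>, so that the suprema are meaningful
  for every sequence, including those for which they are infinite.\<close>

definition dyadic_maximal :: "(int \<Rightarrow> real) \<Rightarrow> int \<Rightarrow> ennreal" where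
  "dyadic_maximal a m =
     (SUP I\<in>{I \<in> dyadic_intervals. m \<in> I}. ennreal (interval_avg (\<lambda>k. \<bar>a k\<bar>) I))"

definition sharp_maximal :: "(int \<Rightarrow> real) \<Rightarrow> int \<Rightarrow> ennreal" where
  "sharp_maximal a m =
     (SUP I\<in>{I \<in> int_intervals. m \<in> I}.
        ennreal (interval_avg (\<lambda>n. \<bar>a n - interval_avg a I\<bar>) I))"

definition in_lp :: "real \<Rightarrow> (int \<Rightarrow> real) \<Rightarrow> bool" where
  "in_lp p a \<longleftrightarrow> (\<lambda>n. \<bar>a n\<bar> powr p) summable_on UNIV"

text \<open>Cardinality with value \<open>\<infinity>\<close> on infinite sets (where \<^const>\<open>card\<close> would be 0).\<close>

definition ext_card :: "int set \<Rightarrow> ennreal" where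
  "ext_card S = emeasure (count_space UNIV) S"

end

theory Submission
  imports Defs
begin

text \<open>Since \<open>a \<in> \<ell>\<^sup>p\<close>, only finitely many dyadic intervals have average exceeding a given positive level.
  Let \<open>Q\<close> be a maximal dyadic interval with average of \<open>\<bar>a\<bar>\<close> exceeding \<open>\<lambda>\<close> and let \<open>P\<close> be its dyadic
  parent, so that \<open>\<bar>a\<^sub>P\<bar> \<le> \<lambda>\<close>. A dyadic \<open>R \<subseteq> Q\<close> with average exceeding \<open>2\<lambda>\<close> satisfies
  \<open>\<lambda>\<bar>R\<bar> < \<Sum>\<^sub>R \<bar>a - a\<^sub>P\<bar>\<close>. Summing over the maximal such \<open>R\<close>, which are disjoint, bounds their union by
  \<open>\<lambda>\<^sup>-\<^sup>1 \<Sum>\<^sub>P \<bar>a - a\<^sub>P\<bar> \<le> \<gamma>\<bar>P\<bar> = 2\<gamma>\<bar>Q\<bar>\<close> as soon as \<open>M\<^sup># a \<le> \<gamma>\<lambda>\<close> somewhere in \<open>Q\<close>.\<close>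

section \<open>Maximal members of a family of sets\<close>

definition maximal_sets :: "'a set set \<Rightarrow> 'a set set" where
  "maximal_sets F = {I \<in> F. \<forall>J\<in>F. I \<subseteq> J \<longrightarrow> I = J}"

lemma maximal_sets_subset: "maximal_sets F \<subseteq> F"
  by (auto simp: maximal_sets_def)

lemma maximal_setsD: "I \<in> maximal_sets F \<Longrightarrow> J \<in> F \<Longrightarrow> I \<subseteq> J \<Longrightarrow> I = J"
  by (auto simp: maximal_sets_def)

lemma subset_maximal_set:
  assumes "finite F" "I \<in> F"
  obtains J where "J \<in> maximal_sets F" "I \<subseteq> J"
  using finite_has_maximal2[OF assms] by (auto simp: maximal_sets_def)

lemma Union_maximal_sets: "finite F \<Longrightarrow> \<Union>(maximal_sets F) = \<Union>F"
  using maximal_sets_subset by (blast elim: subset_maximal_set)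

text \<open>Two maximal members that meet are nested by the assumption, and maximality then makes
  them equal.\<close>

lemma disjoint_maximal_sets:
  assumes "\<And>I J. I \<in> F \<Longrightarrow> J \<in> F \<Longrightarrow> I \<inter> J \<noteq> {} \<Longrightarrow> I \<subseteq> J \<or> J \<subseteq> I"
  shows "disjoint (maximal_sets F)"
proof (rule disjointI)
  fix I J assume "I \<in> maximal_sets F" "J \<in> maximal_sets F" "I \<noteq> J"
  then show "I \<inter> J = {}"
    using assms[of I J] by (auto simp: maximal_sets_def)
qed

section \<open>Nesting of dyadic intervals\<close>

text \<open>The shift by 1 reflects that the intervals start just after a multiple of
  \<open>2 ^ N\<close>. At a fixed scale they are the fibres of a floor division, which turns
  questions of nesting into arithmetic of \<open>div\<close>.\<close>

lemma mem_dyadic_interval: "n \<in> dyadic_interval N j \<longleftrightarrow> (n - 1) div 2 ^ N = j - 1"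
proof
  assume "n \<in> dyadic_interval N j"
  then have "(n - 1) - (j - 1) * 2 ^ N \<in> {0..<2 ^ N}"
    by (auto simp: dyadic_interval_def algebra_simps)
  then have "((n - 1 - (j - 1) * 2 ^ N) + (j - 1) * 2 ^ N) div 2 ^ N = j - 1"
    by (subst div_mult_self1) auto
  then show "(n - 1) div 2 ^ N = j - 1" by simp
next
  assume *: "(n - 1) div 2 ^ N = j - 1"
  have "n - 1 = (j - 1) * 2 ^ N + (n - 1) mod 2 ^ N"
    using div_mult_mod_eq[of "n - 1" "2 ^ N"] * by simp
  moreover have "0 \<le> (n - 1) mod 2 ^ N" "(n - 1) mod 2 ^ N < 2 ^ N" by simp_all
  ultimately have "(j - 1) * 2 ^ N < n" "n - 1 < (j - 1) * 2 ^ N + 2 ^ N" by linarith+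
  then show "n \<in> dyadic_interval N j"
    by (auto simp: dyadic_interval_def algebra_simps)
qed

lemma dyadic_interval_subset:
  assumes "N \<le> M" "n \<in> dyadic_interval N i" "n \<in> dyadic_interval M j"
  shows "dyadic_interval N i \<subseteq> dyadic_interval M j"
proof
  fix k assume "k \<in> dyadic_interval N i"
  then have *: "(k - 1) div 2 ^ N = (n - 1) div 2 ^ N"
    using assms(2) by (simp add: mem_dyadic_interval)
  \<comment> \<open>Division by \<open>2 ^ M\<close> factors through division by
    \<open>2 ^ N\<close>, so the fine block of a point determines its coarse block.\<close>
  have "(x - 1) div 2 ^ M = (x - 1) div 2 ^ N div 2 ^ (M - N)" for x :: int
    using assms(1) by (simp add: div_mult2_eq[symmetric] zdiv_zmult2_eq[symmetric] power_add[symmetric])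
  then show "k \<in> dyadic_interval M j"
    using * assms(3) by (simp add: mem_dyadic_interval)
qed

lemma dyadic_intervals_laminar:
  assumes "I \<in> dyadic_intervals" "J \<in> dyadic_intervals" "I \<inter> J \<noteq> {}"
  shows "I \<subseteq> J \<or> J \<subseteq> I"
proof -
  obtain N i M j where "I = dyadic_interval N i" "J = dyadic_interval M j"
    using assms(1,2) by (auto simp: dyadic_intervals_def)
  moreover obtain n where "n \<in> I" "n \<in> J" using assms(3) by blast
  ultimately show ?thesis
    using dyadic_interval_subset nat_le_linear[of N M] by blast
qed

lemma card_dyadic_interval [simp]: "card (dyadic_interval N j) = 2 ^ N"
  by (simp add: dyadic_interval_def algebra_simps nat_power_eq)

lemma finite_dyadic_interval [simp]: "finite (dyadic_interval N j)"
  by (simp add: dyadic_interval_def)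

lemma dyadic_interval_in_int_intervals: "dyadic_interval N j \<in> int_intervals"
proof -
  have "(j - 1) * 2 ^ N + 1 \<le> j * 2 ^ N" by (simp add: algebra_simps)
  then show ?thesis unfolding int_intervals_def dyadic_interval_def by blast
qed

lemma dyadic_intervalsE:
  assumes "I \<in> dyadic_intervals"
  obtains N j where "1 \<le> N" "I = dyadic_interval N j" "finite I" "0 < card I"
  using assms unfolding dyadic_intervals_def by force

lemma dyadic_parent:
  assumes "Q \<in> dyadic_intervals"
  obtains P where "P \<in> dyadic_intervals" "P \<in> int_intervals" "Q \<subset> P" "finite P" "card P = 2 * card Q"
proof -
  obtain N j where N: "1 \<le> N" and Q: "Q = dyadic_interval N j"
    using assms by (rule dyadic_intervalsE)
  have "j * 2 ^ N \<in> Q" by (simp add: Q dyadic_interval_def algebra_simps)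
  \<comment> \<open>The index is that of the block at scale \<open>Suc N\<close> containing the
    right endpoint \<open>j * 2 ^ N\<close> of \<open>Q\<close>.\<close>
  define P where "P = dyadic_interval (Suc N) ((j * 2 ^ N - 1) div 2 ^ Suc N + 1)"
  have "j * 2 ^ N \<in> P"
    unfolding P_def mem_dyadic_interval by simp
  then have "Q \<subseteq> P"
    using \<open>j * 2 ^ N \<in> Q\<close> dyadic_interval_subset[of N "Suc N"] unfolding Q P_def by simp
  moreover have "card P = 2 * card Q" by (simp add: P_def Q)
  moreover from this have "P \<noteq> Q" by (auto simp: Q)
  moreover have "P \<in> dyadic_intervals" unfolding dyadic_intervals_def P_def by force
  ultimately show thesis
    using that dyadic_interval_in_int_intervals finite_dyadic_interval unfolding P_def by blast
qed

section \<open>Finiteness of the large dyadic intervals\<close>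

text \<open>Chebyshev's inequality: each point of the set contributes at least
  \<open>e powr p\<close> to a convergent sum, which bounds the size of all finite subsets
  uniformly.\<close>

lemma finite_superlevel_of_in_lp:
  assumes "in_lp p a" "0 < p" "0 < e"
  shows "finite {k. e < \<bar>a k\<bar>}"
proof -
  let ?S = "\<Sum>\<^sub>\<infinity>k. \<bar>a k\<bar> powr p"
  have "card G \<le> nat \<lfloor>?S / e powr p\<rfloor>" if G: "G \<subseteq> {k. e < \<bar>a k\<bar>}" "finite G" for G
  proof -
    have "real (card G) * e powr p = (\<Sum>k\<in>G. e powr p)" by simp
    also have "\<dots> \<le> (\<Sum>k\<in>G. \<bar>a k\<bar> powr p)"
      using G assms by (intro sum_mono powr_mono2) auto
    also have "\<dots> \<le> ?S"
      using assms(1) G by (intro finite_sum_le_infsum) (auto simp: in_lp_def)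
    finally have "real (card G) \<le> ?S / e powr p"
      using assms(3) by (simp add: field_simps)
    then show ?thesis by linarith
  qed
  then show ?thesis using finite_if_finite_subsets_card_bdd by blast
qed

definition large_dyadic :: "(int \<Rightarrow> real) \<Rightarrow> real \<Rightarrow> int set set" where
  "large_dyadic a t = {I \<in> dyadic_intervals. t < interval_avg (\<lambda>k. \<bar>a k\<bar>) I}"

lemma large_dyadic_sum:
  assumes "I \<in> large_dyadic a t"
  shows "t * real (card I) < (\<Sum>k\<in>I. \<bar>a k\<bar>)"
proof -
  have "0 < card I" using assms by (auto simp: large_dyadic_def elim: dyadic_intervalsE)
  then show ?thesis
    using assms by (simp add: large_dyadic_def interval_avg_def field_simps)
qed

text \<open>Values up to \<open>t / 2\<close> supply at most half of \<open>t * card I\<close>, so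
  the rest comes from the finite set \<open>G\<close>. Hence \<open>I\<close> meets \<open>G\<close>
  and its length is less than \<open>2 * S / t\<close>. A scale and a point determine a dyadic
  interval, which leaves finitely many.\<close>

lemma finite_large_dyadic:
  assumes "in_lp p a" "0 < p" "0 < t"
  shows "finite (large_dyadic a t)"
proof -
  define G where "G = {k. t / 2 < \<bar>a k\<bar>}"
  define S where "S = (\<Sum>k\<in>G. \<bar>a k\<bar>)"
  define K where "K = nat \<lceil>2 * S / t\<rceil>"
  have G: "finite G"
    unfolding G_def using assms by (intro finite_superlevel_of_in_lp[of p]) auto
  have "large_dyadic a t \<subseteq> (\<lambda>(N, n). dyadic_interval N ((n - 1) div 2 ^ N + 1)) ` ({..K} \<times> G)"
  proof
    fix I assume I: "I \<in> large_dyadic a t"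
    then obtain N j where Ij: "I = dyadic_interval N j" and "finite I"
      by (auto simp: large_dyadic_def elim: dyadic_intervalsE)
    have "(\<Sum>k\<in>I. \<bar>a k\<bar>) = (\<Sum>k\<in>I \<inter> G. \<bar>a k\<bar>) + (\<Sum>k\<in>I - G. \<bar>a k\<bar>)"
      using \<open>finite I\<close> by (rule sum.Int_Diff)
    moreover have "(\<Sum>k\<in>I - G. \<bar>a k\<bar>) \<le> t / 2 * real (card I)"
    proof -
      have "(\<Sum>k\<in>I - G. \<bar>a k\<bar>) \<le> real (card (I - G)) * (t / 2)"
        by (rule sum_bounded_above) (auto simp: G_def)
      also have "\<dots> \<le> real (card I) * (t / 2)"
        using \<open>finite I\<close> assms(3) by (intro mult_right_mono) (auto intro: card_mono)
      finally show ?thesis by (simp add: mult.commute)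
    qed
    ultimately have gt: "t / 2 * real (card I) < (\<Sum>k\<in>I \<inter> G. \<bar>a k\<bar>)"
      using large_dyadic_sum[OF I] by simp
    have "(\<Sum>k\<in>I \<inter> G. \<bar>a k\<bar>) \<le> S"
      unfolding S_def using G by (intro sum_mono2) auto
    then have "real (card I) < 2 * S / t"
      using gt assms(3) by (simp add: field_simps)
    then have "card I \<le> K" unfolding K_def by linarith
    then have "N \<le> K"
      using less_exp[of N] unfolding Ij card_dyadic_interval by linarith
    moreover obtain n where "n \<in> I" "n \<in> G"
    proof (cases "I \<inter> G = {}")
      case True
      then have "(\<Sum>k\<in>I \<inter> G. \<bar>a k\<bar>) = 0" by simp
      then show ?thesis using gt assms(3) by (simp add: mult_less_0_iff)
    qed blast
    moreover from this have "j = (n - 1) div 2 ^ N + 1"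
      by (simp add: Ij mem_dyadic_interval)
    ultimately show "I \<in> (\<lambda>(N, n). dyadic_interval N ((n - 1) div 2 ^ N + 1)) ` ({..K} \<times> G)"
      unfolding Ij by blast
  qed
  then show ?thesis
    using G by (meson finite_SigmaI finite_atMost finite_imageI finite_subset)
qed

text \<open>A supremum exceeds \<open>t\<close> strictly iff some member does. Nonnegativity matters
  because \<open>ennreal\<close> sends negative numbers to 0.\<close>

lemma dyadic_maximal_superlevel:
  assumes "0 \<le> t"
  shows "{n. ennreal t < dyadic_maximal a n} = \<Union>(large_dyadic a t)"
  using assms
  by (auto simp: dyadic_maximal_def large_dyadic_def less_SUP_iff ennreal_less_iff)

lemma sharp_maximal_le_avg:
  assumes "sharp_maximal a n \<le> ennreal t" "0 \<le> t" "P \<in> int_intervals" "n \<in> P"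
  shows "interval_avg (\<lambda>k. \<bar>a k - interval_avg a P\<bar>) P \<le> t"
proof -
  have "ennreal (interval_avg (\<lambda>k. \<bar>a k - interval_avg a P\<bar>) P) \<le> sharp_maximal a n"
    unfolding sharp_maximal_def using assms by (intro SUP_upper) auto
  then show ?thesis
    using assms by (meson ennreal_le_iff order_trans)
qed

lemma disjoint_maximal_large_dyadic: "disjoint (maximal_sets (large_dyadic a t))"
  by (rule disjoint_maximal_sets) (auto simp: large_dyadic_def dest: dyadic_intervals_laminar)

section \<open>The good-lambda inequality\<close>

text \<open>Local form of the theorem on one maximal interval \<open>Q\<close>; the factor 2 is the
  ratio of the parent's length to that of \<open>Q\<close>.\<close>

lemma card_good_part_le:
  assumes "in_lp p a" "0 < p" "0 < \<gamma>" "0 < lam"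
    and Q: "Q \<in> maximal_sets (large_dyadic a lam)"
  defines "B \<equiv> {n \<in> Q. ennreal (2 * lam) < dyadic_maximal a n \<and> sharp_maximal a n \<le> ennreal (\<gamma> * lam)}"
  shows "real (card B) \<le> 2 * \<gamma> * real (card Q)"
proof (cases "B = {}")
  case True
  then have "card B = 0" by (rule ssubst) simp
  then show ?thesis using assms(3) by simp
next
  case False
  then obtain n where n: "n \<in> Q" "sharp_maximal a n \<le> ennreal (\<gamma> * lam)"
    by (auto simp: B_def)
  have Qd: "Q \<in> large_dyadic a lam" using Q maximal_sets_subset by blast
  then have "Q \<in> dyadic_intervals" by (simp add: large_dyadic_def)
  then obtain P where P: "P \<in> dyadic_intervals" "P \<in> int_intervals" "Q \<subset> P" "finite P"
    and cP: "card P = 2 * card Q"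
    by (rule dyadic_parent)
  define c where "c = interval_avg a P"
  \<comment> \<open>The parent strictly contains \<open>Q\<close>, so maximality of \<open>Q\<close>
    keeps its average at most \<open>lam\<close>.\<close>
  have "P \<notin> large_dyadic a lam" using maximal_setsD[OF Q] P(3) by blast
  then have "interval_avg (\<lambda>k. \<bar>a k\<bar>) P \<le> lam" using P(1) by (simp add: large_dyadic_def)
  moreover have "\<bar>c\<bar> \<le> interval_avg (\<lambda>k. \<bar>a k\<bar>) P"
    by (simp add: c_def interval_avg_def abs_divide divide_right_mono sum_abs)
  ultimately have c: "\<bar>c\<bar> \<le> lam" by linarith
  have "n \<in> P" using n P by blast
  then have Pcard: "0 < card P" using P(4) card_gt_0_iff by blast
  have "interval_avg (\<lambda>k. \<bar>a k - c\<bar>) P \<le> \<gamma> * lam"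
    unfolding c_def using n \<open>n \<in> P\<close> P assms by (intro sharp_maximal_le_avg) auto
  \<comment> \<open>The single point \<open>n\<close> of \<open>B\<close> controls the oscillation
    on all of \<open>P\<close>.\<close>
  then have osc: "(\<Sum>k\<in>P. \<bar>a k - c\<bar>) \<le> \<gamma> * lam * real (card P)"
    using Pcard by (simp add: interval_avg_def field_simps)
  define H where "H = {R \<in> maximal_sets (large_dyadic a (2 * lam)). R \<subseteq> Q}"
  have fin: "finite (large_dyadic a (2 * lam))" "finite (large_dyadic a lam)"
    using assms by (auto intro!: finite_large_dyadic[of p])
  have Hsub: "H \<subseteq> large_dyadic a (2 * lam)" unfolding H_def using maximal_sets_subset by blast
  have finH: "finite H" using fin Hsub finite_subset by blast
  have finR: "finite R" if "R \<in> H" for R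
    using that P by (auto simp: H_def intro: finite_subset)
  have disH: "R \<inter> R' = {}" if "R \<in> H" "R' \<in> H" "R \<noteq> R'" for R R'
    using that disjoint_maximal_large_dyadic by (auto simp: H_def dest!: disjointD)
  have "B \<subseteq> \<Union>H"
  proof
    fix m assume m: "m \<in> B"
    then have "m \<in> \<Union>(large_dyadic a (2 * lam))"
      using dyadic_maximal_superlevel[of "2 * lam" a] assms by (auto simp: B_def)
    then obtain R where R: "R \<in> maximal_sets (large_dyadic a (2 * lam))" "m \<in> R"
      using Union_maximal_sets[OF fin(1)] by blast
    then have "R \<in> large_dyadic a lam"
      using maximal_sets_subset assms by (fastforce simp: large_dyadic_def)
    then obtain Q' where Q': "Q' \<in> maximal_sets (large_dyadic a lam)" "R \<subseteq> Q'"
      using subset_maximal_set[OF fin(2)] by blast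
    \<comment> \<open>Both are maximal at level \<open>lam\<close> and contain \<open>m\<close>, so
      disjointness identifies them and \<open>R\<close> lies inside \<open>Q\<close>.\<close>
    have "Q' = Q"
      using disjoint_maximal_large_dyadic[of a lam] Q' Q R m by (force simp: B_def dest: disjointD)
    then show "m \<in> \<Union>H" using Q' R by (auto simp: H_def)
  qed
  \<comment> \<open>Replacing \<open>a\<close> by \<open>a - c\<close> costs at most
    \<open>lam\<close> per point, which leaves half of the level \<open>2 * lam\<close>.\<close>
  have each: "lam * real (card R) \<le> (\<Sum>k\<in>R. \<bar>a k - c\<bar>)" if "R \<in> H" for R
  proof -
    have "2 * lam * real (card R) \<le> (\<Sum>k\<in>R. \<bar>a k\<bar>)"
      using large_dyadic_sum[of R a "2 * lam"] that Hsub by auto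
    also have "\<dots> \<le> (\<Sum>k\<in>R. \<bar>a k - c\<bar> + lam)"
      using c by (intro sum_mono) linarith
    finally show ?thesis by (simp add: sum.distrib algebra_simps)
  qed
  have "real (card B) \<le> real (card (\<Union>H))"
    using \<open>B \<subseteq> \<Union>H\<close> finH finR by (auto intro!: card_mono)
  also have "card (\<Union>H) = (\<Sum>R\<in>H. card R)"
    using finR disH by (intro card_Union_disjoint) (auto simp: pairwise_def disjnt_def)
  finally have "lam * real (card B) \<le> (\<Sum>R\<in>H. lam * real (card R))"
    using assms by (simp add: sum_distrib_left[symmetric])
  also have "\<dots> \<le> (\<Sum>R\<in>H. \<Sum>k\<in>R. \<bar>a k - c\<bar>)"
    using each by (rule sum_mono)
  also have "\<dots> = (\<Sum>k\<in>\<Union>H. \<bar>a k - c\<bar>)"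
    using finR disH by (subst sum.Union_disjoint) auto
  also have "\<dots> \<le> (\<Sum>k\<in>P. \<bar>a k - c\<bar>)"
    using P by (intro sum_mono2) (auto simp: H_def)
  also have "\<dots> \<le> lam * (2 * \<gamma> * real (card Q))"
    using osc by (simp add: cP mult_ac)
  finally show ?thesis using assms by simp
qed

theorem lemma4p6:
  fixes a :: "int \<Rightarrow> real" and p0 \<gamma> lam :: real
  assumes "1 \<le> p0" and "in_lp p0 a" and "0 < \<gamma>" and "0 < lam"
  shows "ext_card {n. dyadic_maximal a n > ennreal (2 * lam) \<and> sharp_maximal a n \<le> ennreal (\<gamma> * lam)}
           \<le> ennreal (2 * \<gamma>) * ext_card {n. dyadic_maximal a n > ennreal lam}"
proof -
  let ?M = "maximal_sets (large_dyadic a lam)"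
  let ?E = "{n. dyadic_maximal a n > ennreal lam}"
  let ?B = "{n. dyadic_maximal a n > ennreal (2 * lam) \<and> sharp_maximal a n \<le> ennreal (\<gamma> * lam)}"
  have p0: "0 < p0" using assms by simp
  have fin: "finite (large_dyadic a lam)"
    using assms by (intro finite_large_dyadic[of p0]) auto
  have finM: "finite ?M" using fin maximal_sets_subset finite_subset by blast
  have finQ: "finite Q" if "Q \<in> ?M" for Q
    using that maximal_sets_subset by (fastforce simp: large_dyadic_def elim: dyadic_intervalsE)
  have E: "?E = \<Union>?M"
    using dyadic_maximal_superlevel[of lam a] Union_maximal_sets[OF fin] assms by simp
  \<comment> \<open>With \<open>?E\<close> finite, \<open>ext_card\<close> agrees with
    \<open>card\<close> on both sides of the claim.\<close>
  have finE: "finite ?E" unfolding E using finM finQ by blast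
  have BE: "?B \<subseteq> ?E"
  proof safe
    fix n assume "ennreal (2 * lam) < dyadic_maximal a n"
    moreover have "ennreal lam \<le> ennreal (2 * lam)" using assms by (intro ennreal_leI) simp
    ultimately show "ennreal lam < dyadic_maximal a n" by (rule order.strict_trans1[rotated])
  qed
  \<comment> \<open>The maximal intervals cover \<open>?B\<close>, so it splits into the pieces to
    which the local estimate applies.\<close>
  have "X = (\<Union>Q\<in>?M. {n \<in> Q. n \<in> X})" if "X \<subseteq> \<Union>?M" for X using that by blast
  from this[OF BE[unfolded E]] have "?B = (\<Union>Q\<in>?M. {n \<in> Q. n \<in> ?B})" .
  then have "card ?B = card (\<Union>Q\<in>?M. {n \<in> Q. n \<in> ?B})" by (rule arg_cong[where f = card])
  also have "\<dots> \<le> (\<Sum>Q\<in>?M. card {n \<in> Q. n \<in> ?B})"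
    using finM by (rule card_UN_le)
  finally have "real (card ?B) \<le> (\<Sum>Q\<in>?M. real (card {n \<in> Q. n \<in> ?B}))"
    unfolding of_nat_sum[symmetric] of_nat_le_iff .
  also have "\<dots> \<le> (\<Sum>Q\<in>?M. 2 * \<gamma> * real (card Q))"
    using card_good_part_le[OF assms(2) p0 assms(3,4)] by (intro sum_mono) simp
  also have "\<dots> = 2 * \<gamma> * real (\<Sum>Q\<in>?M. card Q)"
    by (simp add: sum_distrib_left)
  also have "(\<Sum>Q\<in>?M. card Q) = card ?E"
    unfolding E using finQ disjoint_maximal_large_dyadic
    by (intro card_Union_disjoint[symmetric]) (auto simp: disjoint_def pairwise_def disjnt_def)
  finally have "ennreal (real (card ?B)) \<le> ennreal (2 * \<gamma> * real (card ?E))"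
    by (rule ennreal_leI)
  also have "\<dots> = ennreal (2 * \<gamma>) * ennreal (real (card ?E))"
    using assms by (intro ennreal_mult) auto
  finally show ?thesis
    using finE finite_subset[OF BE finE]
    by (simp add: ext_card_def emeasure_count_space_finite ennreal_of_nat_eq_real_of_nat)
qed

end
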